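(* Let $V$ be a digraph on $\mathcal N=\{1,\dots,N\}$ with real arc weights, let $2\le k\le N-1$ with $\mathcal F^{k-1}(V)\neq\emptyset$, and suppose $\varphi_{k-1}-\varphi_k=\varphi_k-\varphi_{k+1}$. Then 1) $\aleph_k=\aleph_{k+1}$; 2) for every elementary set $\mathcal E$ of $\aleph_k$, $\tilde{\mathcal F}^{k-1}(V)|_{\mathcal E}\subseteq\tilde{\mathcal F}^{k}(V)|_{\mathcal E}\supseteq\tilde{\mathcal F}^{k+1}(V)|_{\mathcal E}$.
   Context: $V$ is a directed graph with vertex set $\mathcal N$, arc set $\mathcal A V\subseteq\mathcal N^2$, and real weights $v_{ij}$ on arcs $(i,j)$. A forest is a digraph without directed circuits (loops count as circuits) in which every vertex has outdegree $0$ or $1$; its trees are its weakly connected components; the root of a tree is its unique vertex of outdegree $0$. $\mathcal F^k(V)$ is the set of spanning subgraphs of $V$ that are forests with exactly $k$ trees; $\Sigma^F=\sum_{(i,j)\in\mathcal A F}v_{ij}$; $\varphi_k=\min_{F\in\mathcal F^k(V)}\Sigma^F$ ($+\infty$ if empty); $\tilde{\mathcal F}^k(V)=\{F\in\mathcal F^k(V):\Sigma^F=\varphi_k\}$. $\aleph_k$ is the algebra of subsets of $\mathcal N$ generated by the vertex sets of all trees of all forests in $\tilde{\mathcal F}^k(V)$; its elementary sets are its minimal nonempty members (atoms). For a digraph $H$ and $\mathcal S\subseteq\mathcal N$, $H|_{\mathcal S}$ is the induced subgraph with vertex set $\mathcal S$ and the arcs of $H$ with both endpoints in $\mathcal S$;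 for a set $\mathcal G$ of digraphs, $\mathcal G|_{\mathcal S}=\{H|_{\mathcal S}:H\in\mathcal G\}$. *)

theory Defs
  imports "HOL-Analysis.Sigma_Algebra" "HOL-Library.Extended_Real" "Graph_Theory.Graph_Theory"
begin

text \<open>The predicate \<^const>\<open>forest\<close> of the library excludes exactly the directed cycles, and a loop
  is a cycle there.  A directed forest in addition has all outdegrees at most one, so that arcs
  point towards the roots.\<close>

definition directed_forest :: "('a, 'b) pre_digraph \<Rightarrow> bool" where
  "directed_forest F \<longleftrightarrow> fin_digraph F \<and> forest F \<and> (\<forall>u \<in> verts F. out_degree F u \<le> 1)"

text \<open>Weakly connected components; \<^const>\<open>Digraph_Component.connected\<close> is weak connectivity.\<close>

definition trees :: "('a, 'b) pre_digraph \<Rightarrow> ('a, 'b) pre_digraph set" where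
  "trees F = {T. pre_digraph.max_subgraph F Digraph_Component.connected T}"

definition spanning_forests :: "('a, 'b) pre_digraph \<Rightarrow> nat \<Rightarrow> ('a, 'b) pre_digraph set" where
  "spanning_forests V k = {F. spanning F V \<and> directed_forest F \<and> card (trees F) = k}"

definition weight :: "('b \<Rightarrow> real) \<Rightarrow> ('a, 'b) pre_digraph \<Rightarrow> real" where
  "weight v F = (\<Sum>e \<in> arcs F. v e)"

text \<open>For a finite digraph the infimum ranges over a finite set, so it is a minimum unless the set
  is empty, in which case it is \<open>\<infinity>\<close>.\<close>

definition min_weight :: "('a, 'b) pre_digraph \<Rightarrow> ('b \<Rightarrow> real) \<Rightarrow> nat \<Rightarrow> ereal" where
  "min_weight V v k = (INF F \<in> spanning_forests V k. ereal (weight v F))"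

definition min_forests ::
  "('a, 'b) pre_digraph \<Rightarrow> ('b \<Rightarrow> real) \<Rightarrow> nat \<Rightarrow> ('a, 'b) pre_digraph set" where
  "min_forests V v k = {F \<in> spanning_forests V k. ereal (weight v F) = min_weight V v k}"

definition tree_algebra ::
  "('a, 'b) pre_digraph \<Rightarrow> ('b \<Rightarrow> real) \<Rightarrow> nat \<Rightarrow> 'a set set" where
  "tree_algebra V v k =
    \<Inter> {M. algebra (verts V) M \<and> (\<forall>F \<in> min_forests V v k. verts ` trees F \<subseteq> M)}"

definition elementary_sets :: "'a set set \<Rightarrow> 'a set set" where
  "elementary_sets M = {E \<in> M. E \<noteq> {} \<and> (\<forall>S \<in> M. S \<noteq> {} \<and> S \<subseteq> E \<longrightarrow> S = E)}"

definition restrict_graphs ::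
  "('a, 'b) pre_digraph set \<Rightarrow> 'a set \<Rightarrow> ('a, 'b) pre_digraph set" where
  "restrict_graphs \<G> S = (\<lambda>H. H \<restriction> S) ` \<G>"

end

theory Submission
  imports Defs
begin

text \<open>Forests are handled through their arc relations: single-valued and acyclic.  If a tree \<open>S\<close> of a
  forest \<open>G\<close> contains no root of a forest \<open>F\<close>, then exchanging the arcs that start in \<open>S\<close> between \<open>F\<close> and
  \<open>G\<close> gives two forests of the same total weight; \<open>F\<close> gains a root and \<open>G\<close> loses one.  For
  \<open>F\<close>, \<open>G\<close> minimal with \<open>k - 1\<close> and \<open>k + 1\<close> trees there are at least two such \<open>S\<close>, and under the
  assumption on the weights both results are minimal with \<open>k\<close> trees.  An elementary set misses one
  of the two disjoint sets \<open>S\<close>, and off that set nothing has changed, which gives the second claim.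
  For the equality of the algebras the exchange is also done on parts \<open>D\<close> of \<open>S\<close> that no arc
  of \<open>F\<close> connects with \<open>S - D\<close>: the two partial exchanges add up to the full one, so both are minimal.\<close>

section \<open>Exchanging arcs of forests\<close>

definition roots :: "'a set \<Rightarrow> 'a rel \<Rightarrow> 'a set" where
  "roots U A = U - Domain A"

text \<open>For a root \<open>r\<close> of a forest \<open>A\<close> this is the vertex set of the
  tree of \<open>r\<close>, since arcs point towards roots.\<close>

definition tree_of :: "'a rel \<Rightarrow> 'a \<Rightarrow> 'a set" where
  "tree_of A r = {x. (x, r) \<in> A\<^sup>*}"

text \<open>Arcs are replaced according to their start, so single-valuedness survives every graft
  and only acyclicity needs an argument.\<close>

definition graft :: "'a rel \<Rightarrow> 'a set \<Rightarrow> 'a rel \<Rightarrow> 'a rel" where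
  "graft A D B = {(x, y) \<in> A. x \<notin> D} \<union> {(x, y) \<in> B. x \<in> D}"

lemma in_graft_iff: "(x, y) \<in> graft A D B \<longleftrightarrow> (if x \<in> D then (x, y) \<in> B else (x, y) \<in> A)"
  by (auto simp: graft_def)

lemma graft_Compl: "graft A (- D) B = graft B D A"
  by (auto simp: graft_def)

lemma single_valued_graft:
  "single_valued A \<Longrightarrow> single_valued B \<Longrightarrow> single_valued (graft A D B)"
  unfolding single_valued_def in_graft_iff by meson

lemma roots_graft: "roots U (graft A D B) = (roots U A - D) \<union> (roots U B \<inter> D)"
  by (auto simp: roots_def graft_def)

text \<open>Once outside \<open>D\<close>, a path of the graft follows \<open>A\<close> and never
  comes back. So a cycle lies wholly in \<open>D\<close>, as a cycle of \<open>B\<close>, or wholly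
  outside, as a cycle of \<open>A\<close>.\<close>

lemma acyclic_graft_Compl_closed:
  assumes "acyclic A" "acyclic B" "A `` (- D) \<subseteq> - D"
  shows "acyclic (graft A D B)"
proof (rule acyclicI, intro allI notI)
  let ?C = "graft A D B"
  have off: "(x, y) \<in> A\<^sup>+ \<and> y \<notin> D" if "(x, y) \<in> ?C\<^sup>+" "x \<notin> D" for x y
    using that
  proof (induction rule: trancl_induct)
    case (base y)
    then show ?case using assms(3) by (auto simp: in_graft_iff)
  next
    case (step y z)
    then show ?case using assms(3) by (auto simp: in_graft_iff intro: trancl_into_trancl)
  qed
  have on: "y \<in> D \<longrightarrow> (x, y) \<in> B\<^sup>+" if "(x, y) \<in> ?C\<^sup>+" for x y
    using that
  proof (induction rule: trancl_induct)
    case (base y)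
    then show ?case using assms(3) by (auto simp: in_graft_iff split: if_splits)
  next
    case (step y z)
    then show ?case using assms(3)
      by (auto simp: in_graft_iff split: if_splits intro: trancl_into_trancl)
  qed
  fix x assume "(x, x) \<in> ?C\<^sup>+"
  with on[of x x] off[of x x] show False
    using assms(1,2) by (auto simp: acyclic_def)
qed

lemma acyclic_graft_closed:
  assumes "acyclic A" "acyclic B" "B `` D \<subseteq> D"
  shows "acyclic (graft A D B)"
  using acyclic_graft_Compl_closed[of B A "- D"] assms by (simp add: graft_Compl)

text \<open>Graft on all of \<open>S\<close> first, then restore \<open>A\<close> on
  \<open>S - D\<close>. The remaining set \<open>D \<union> - S\<close> is closed under the first
  graft, because arcs of \<open>B\<close> from \<open>D\<close> avoid \<open>S - D\<close>.\<close>

lemma acyclic_graft_part: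
  assumes "acyclic A" "acyclic B" "A `` (- S) \<subseteq> - S" "D \<subseteq> S" "B `` D \<inter> (S - D) = {}"
  shows "acyclic (graft A D B)"
proof -
  have "graft A D B = graft A (D \<union> - S) (graft A S B)"
    using assms(4) by (auto simp: graft_def)
  moreover have "graft A S B `` (D \<union> - S) \<subseteq> D \<union> - S"
    using assms(3-5) by (fastforce simp: in_graft_iff split: if_splits)
  ultimately show ?thesis
    using acyclic_graft_closed acyclic_graft_Compl_closed assms(1-3) by metis
qed

lemma sum_graft:
  assumes "finite A" "finite B"
  shows "sum v (graft A D B) = sum v {e \<in> A. fst e \<notin> D} + sum v {e \<in> B. fst e \<in> D}"
proof -
  have "graft A D B = {e \<in> A. fst e \<notin> D} \<union> {e \<in> B. fst e \<in> D}"
    by (auto simp: graft_def)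
  then show ?thesis
    using assms by (simp only:) (rule sum.union_disjoint, auto)
qed

lemma sum_graft_swap:
  fixes v :: "'a \<times> 'a \<Rightarrow> real"
  assumes "finite A" "finite B"
  shows "sum v (graft A D B) + sum v (graft B D A) = sum v A + sum v B"
proof -
  have "graft X D X = X" for X
    by (auto simp: graft_def)
  then have "sum v X = sum v {e \<in> X. fst e \<notin> D} + sum v {e \<in> X. fst e \<in> D}" if "finite X" for X
    using sum_graft[OF that that, of v D] by simp
  from this[of A] this[of B] show ?thesis
    using assms by (simp add: sum_graft)
qed

text \<open>Exchanging the two partial grafts on \<open>S - D\<close> turns one into the full graft
  and the other back into \<open>A\<close>.\<close>

lemma sum_graft_split:
  fixes v :: "'a \<times> 'a \<Rightarrow> real"
  assumes "finite A" "finite B" "D \<subseteq> S"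
  shows "sum v (graft A D B) + sum v (graft A (S - D) B) = sum v A + sum v (graft A S B)"
proof -
  have eq: "graft A S B = graft (graft A D B) (S - D) (graft A (S - D) B)"
     "A = graft (graft A (S - D) B) (S - D) (graft A D B)"
    using assms(3) by (auto simp: graft_def)
  have "finite (graft A D' B)" for D'
    by (rule finite_subset[of _ "A \<union> B"]) (auto simp: graft_def assms)
  then show ?thesis
    using sum_graft_swap[of "graft A D B" "graft A (S - D) B" v "S - D"] eq by simp
qed

section \<open>Trees as sets of vertices that lead to a root\<close>

lemma root_mem_tree_of [simp]: "r \<in> tree_of A r"
  by (simp add: tree_of_def)

lemma tree_of_Compl_closed: "A `` (- tree_of A r) \<subseteq> - tree_of A r"
  by (auto simp: tree_of_def intro: converse_rtrancl_into_rtrancl)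

text \<open>A vertex other than \<open>r\<close> that leads to \<open>r\<close> has the first arc of
  that path as its only outgoing arc; \<open>r\<close> itself has none.\<close>

lemma tree_of_closed:
  assumes "single_valued A" "r \<in> roots U A"
  shows "A `` tree_of A r \<subseteq> tree_of A r"
proof
  fix y assume "y \<in> A `` tree_of A r"
  then obtain x where x: "(x, r) \<in> A\<^sup>*" "(x, y) \<in> A" by (auto simp: tree_of_def)
  with assms(2) have "x \<noteq> r" by (auto simp: roots_def)
  with x(1) obtain z where "(x, z) \<in> A" "(z, r) \<in> A\<^sup>*" by (meson converse_rtranclE)
  with x assms(1) show "y \<in> tree_of A r" by (auto simp: tree_of_def dest: single_valuedD)
qed

lemma tree_of_subset:
  assumes "r \<in> S" "\<And>x y. (x, y) \<in> A \<Longrightarrow> y \<in> S \<Longrightarrow> x \<in> S"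
  shows "tree_of A r \<subseteq> S"
proof
  fix x assume "x \<in> tree_of A r"
  then have "(x, r) \<in> A\<^sup>*" by (simp add: tree_of_def)
  then show "x \<in> S" by (induction rule: converse_rtrancl_induct) (use assms in auto)
qed

lemma rtrancl_agree_on_closed:
  assumes "(x, y) \<in> A\<^sup>*" "x \<in> S" "A `` S \<subseteq> S" "\<And>x y. x \<in> S \<Longrightarrow> (x, y) \<in> A \<Longrightarrow> (x, y) \<in> C"
  shows "(x, y) \<in> C\<^sup>* \<and> y \<in> S"
  using assms(1,2)
  by (induction rule: rtrancl_induct) (use assms(3,4) in \<open>auto intro: rtrancl_into_rtrancl\<close>)

text \<open>Criterion for a tree to survive a graft: its own arcs remain, and no arc of the new
  relation enters it from outside.\<close>

lemma tree_of_eqI: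
  assumes "single_valued A" "r \<in> roots U A"
    and "\<And>x y. x \<in> tree_of A r \<Longrightarrow> (x, y) \<in> A \<Longrightarrow> (x, y) \<in> C"
    and "C `` (- tree_of A r) \<subseteq> - tree_of A r"
  shows "tree_of C r = tree_of A r"
proof
  show "tree_of C r \<subseteq> tree_of A r"
    using assms(4) by (intro tree_of_subset) auto
  show "tree_of A r \<subseteq> tree_of C r"
  proof
    fix x assume x: "x \<in> tree_of A r"
    then have "(x, r) \<in> A\<^sup>*" by (simp add: tree_of_def)
    from rtrancl_agree_on_closed[OF this x tree_of_closed[OF assms(1,2)] assms(3)]
    show "x \<in> tree_of C r" by (simp add: tree_of_def)
  qed
qed

lemma rtrancl_exit:
  assumes "(a, b) \<in> R\<^sup>*" "a \<in> S" "b \<notin> S"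
  obtains x y where "(x, y) \<in> R" "x \<in> S" "y \<notin> S"
  using assms by (induction rule: rtrancl_induct) auto

lemma single_valued_root_unique:
  assumes "single_valued A" "(x, r) \<in> A\<^sup>*" "(x, s) \<in> A\<^sup>*" "r \<in> roots U A" "s \<in> roots U A"
  shows "r = s"
  using single_valued_confluent[OF assms(1-3)] assms(4,5)
  by (auto simp: roots_def elim: converse_rtranclE)

lemma trees_disjoint:
  assumes "single_valued A" "r \<in> roots U A" "s \<in> roots U A" "r \<noteq> s"
  shows "tree_of A r \<inter> tree_of A s = {}"
  using single_valued_root_unique[OF assms(1) _ _ assms(2,3)] assms(4) by (auto simp: tree_of_def)

lemma reaches_root:
  assumes "finite A" "acyclic A" "A \<subseteq> U \<times> U" "x \<in> U"
  obtains r where "r \<in> roots U A" "(x, r) \<in> A\<^sup>*"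
proof -
  have "wf (A\<inverse>)" using assms by (simp add: finite_acyclic_wf_converse)
  then have "x \<in> U \<longrightarrow> (\<exists>r \<in> roots U A. (x, r) \<in> A\<^sup>*)"
  proof (induction x rule: wf_induct_rule)
    case (less x)
    show ?case
    proof (cases "x \<in> Domain A")
      case True
      then obtain y where "(x, y) \<in> A" by auto
      with less[of y] assms(3) show ?thesis by (auto intro: converse_rtrancl_into_rtrancl)
    qed (auto simp: roots_def)
  qed
  with assms(4) that show ?thesis by blast
qed

section \<open>Forests of minimal weight\<close>

locale weighted_arcs =
  fixes U :: "'a set" and E :: "'a rel" and v :: "'a \<times> 'a \<Rightarrow> real"
  assumes finite_U: "finite U" and E_subset: "E \<subseteq> U \<times> U"
begin

text \<open>With the vertex set \<open>U\<close> fixed, a spanning forest is a set of arcs; its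
  trees are counted by their roots, one for each tree.\<close>

definition forests :: "nat \<Rightarrow> 'a rel set" where
  "forests j = {A. A \<subseteq> E \<and> single_valued A \<and> acyclic A \<and> card (roots U A) = j}"

definition optimal :: "nat \<Rightarrow> 'a rel set" where
  "optimal j = {A \<in> forests j. \<forall>B \<in> forests j. sum v A \<le> sum v B}"

definition tree_alg :: "nat \<Rightarrow> 'a set set" where
  "tree_alg j = \<Inter> {M. algebra U M \<and> (\<forall>A \<in> optimal j. tree_of A ` roots U A \<subseteq> M)}"

lemma finite_E: "finite E"
  using finite_subset[OF E_subset] finite_U by blast

lemma finite_roots [simp]: "finite (roots U A)"
  by (simp add: roots_def finite_U)

lemma forestsD:
  assumes "A \<in> forests j"
  shows "A \<subseteq> E" "A \<subseteq> U \<times> U" "finite A" "single_valued A" "acyclic A" "card (roots U A) = j"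
proof -
  show A: "A \<subseteq> E" "single_valued A" "acyclic A" "card (roots U A) = j"
    using assms by (simp_all add: forests_def)
  show "A \<subseteq> U \<times> U" using A(1) E_subset by (rule order_trans)
  show "finite A" using A(1) finite_E by (rule finite_subset)
qed

lemma optimalD: "A \<in> optimal j \<Longrightarrow> A \<in> forests j" "A \<in> optimal j \<Longrightarrow> B \<in> forests j \<Longrightarrow> sum v A \<le> sum v B"
  by (auto simp: optimal_def)

lemma finite_forests: "finite (forests j)"
  by (rule finite_subset[of _ "Pow E"]) (auto simp: forests_def finite_E)

lemma optimal_nonempty:
  assumes "forests j \<noteq> {}"
  shows "optimal j \<noteq> {}"
proof -
  obtain A where "is_arg_min (sum v) (\<lambda>A. A \<in> forests j) A"
    using ex_is_arg_min_if_finite[OF finite_forests assms, of "sum v"] by blast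
  then have "A \<in> optimal j"
    by (auto simp: optimal_def is_arg_min_linorder)
  then show ?thesis by blast
qed

text \<open>Some vertex is not a root, and deleting its outgoing arc makes it one.\<close>

lemma forests_Suc_nonempty:
  assumes "forests j \<noteq> {}" "j < card U"
  shows "forests (Suc j) \<noteq> {}"
proof -
  obtain A where A: "A \<in> forests j" using assms by blast
  from assms(2) forestsD(6)[OF A] have "roots U A \<noteq> U" by auto
  then obtain x y where xy: "(x, y) \<in> A" "x \<in> U" by (auto simp: roots_def)
  let ?B = "{e \<in> A. fst e \<noteq> x}"
  have "roots U ?B = insert x (roots U A)" "x \<notin> roots U A"
    using xy by (auto simp: roots_def)
  moreover have "?B \<subseteq> A" by blast
  moreover have "?B \<subseteq> E" using forestsD(1)[OF A] by blast
  ultimately have "?B \<in> forests (Suc j)"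
    using single_valued_subset[OF _ forestsD(4)[OF A]] acyclic_subset[OF forestsD(5)[OF A]] forestsD(6)[OF A]
    by (simp add: forests_def)
  then show ?thesis by blast
qed

lemma tree_of_subset_U:
  assumes "A \<in> forests j" "r \<in> roots U A"
  shows "tree_of A r \<subseteq> U"
  using assms forestsD(2)[OF assms(1)] by (intro tree_of_subset) (auto simp: roots_def)

lemma ex_root:
  assumes "A \<in> forests j" "x \<in> U"
  obtains r where "r \<in> roots U A" "x \<in> tree_of A r"
proof -
  obtain r where "r \<in> roots U A" "(x, r) \<in> A\<^sup>*"
    using reaches_root forestsD[OF assms(1)] assms(2) by metis
  then show ?thesis using that by (simp add: tree_of_def)
qed

lemma tree_of_inter_roots:
  assumes "A \<in> forests j" "r \<in> roots U A"
  shows "roots U A \<inter> tree_of A r = {r}"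
proof -
  have "s = r" if "s \<in> roots U A" "s \<in> tree_of A r" for s
    using trees_disjoint[OF forestsD(4)[OF assms(1)] that(1) assms(2)] that(2) root_mem_tree_of[of s A]
    by blast
  then show ?thesis using assms(2) by auto
qed

lemma graft_in_forests:
  assumes "A \<in> forests i" "B \<in> forests j" "acyclic (graft A D B)"
  shows "graft A D B \<in> forests (card (roots U A - D) + card (roots U B \<inter> D))"
proof -
  have "card (roots U (graft A D B)) = card (roots U A - D) + card (roots U B \<inter> D)"
    unfolding roots_graft by (rule card_Un_disjoint) auto
  moreover have "graft A D B \<subseteq> E"
    using forestsD(1)[OF assms(1)] forestsD(1)[OF assms(2)] by (auto simp: graft_def)
  ultimately show ?thesis
    using assms(3) single_valued_graft[OF forestsD(4)[OF assms(1)] forestsD(4)[OF assms(2)]]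
    by (simp add: forests_def)
qed

text \<open>Each summand is bounded below by its own minimum, so a total not above the sum of the
  minima forces equality in both.\<close>

lemma optimal_pair:
  assumes "A' \<in> optimal i" "B' \<in> optimal j" "A \<in> forests i" "B \<in> forests j"
    and "sum v A + sum v B \<le> sum v A' + sum v B'"
  shows "A \<in> optimal i \<and> B \<in> optimal j"
proof -
  have *: "sum v A' \<le> sum v C" if "C \<in> forests i" for C using optimalD(2)[OF assms(1) that] .
  have **: "sum v B' \<le> sum v C" if "C \<in> forests j" for C using optimalD(2)[OF assms(2) that] .
  have "sum v A = sum v A'" "sum v B = sum v B'"
    using *[OF assms(3)] **[OF assms(4)] assms(5) by linarith+
  with * ** assms(3,4) show ?thesis by (auto simp: optimal_def)
qed

text \<open>Named by root: the trees of \<open>B\<close> on which the arcs of \<open>A\<close> can be exchanged.\<close>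

definition barren :: "'a rel \<Rightarrow> 'a rel \<Rightarrow> 'a set" where
  "barren A B = {s \<in> roots U B. tree_of B s \<inter> roots U A = {}}"

lemma barrenD:
  assumes "s \<in> barren A B"
  shows "s \<in> roots U B" "tree_of B s \<inter> roots U A = {}"
  using assms by (auto simp: barren_def)

text \<open>Send each root of \<open>A\<close> to the root of the tree of \<open>B\<close>
  containing it. At most \<open>i\<close> trees of \<open>B\<close> are hit, and the others are
  barren.\<close>

lemma card_barren:
  assumes "A \<in> forests i" "B \<in> forests j"
  shows "j \<le> card (barren A B) + i"
proof -
  have "\<forall>r \<in> roots U A. \<exists>s \<in> roots U B. r \<in> tree_of B s"
    using ex_root[OF assms(2)] by (metis DiffD1 roots_def)
  then obtain \<rho> where \<rho>: "\<And>r. r \<in> roots U A \<Longrightarrow> \<rho> r \<in> roots U B \<and> r \<in> tree_of B (\<rho> r)"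
    by metis
  have "s \<in> barren A B" if "s \<in> roots U B - \<rho> ` roots U A" for s
  proof -
    have "r \<notin> tree_of B s" if "r \<in> roots U A" for r
      using trees_disjoint[OF forestsD(4)[OF assms(2)], of "\<rho> r" U s] \<rho>[OF that] that
        \<open>s \<in> roots U B - \<rho> ` roots U A\<close> by blast
    with that show ?thesis by (auto simp: barren_def)
  qed
  then have "roots U B \<subseteq> barren A B \<union> \<rho> ` roots U A" by blast
  then have "card (roots U B) \<le> card (barren A B \<union> \<rho> ` roots U A)"
    by (intro card_mono) (auto simp: barren_def)
  also have "\<dots> \<le> card (barren A B) + card (roots U A)"
    using card_Un_le card_image_le[of "roots U A" \<rho>] by (metis add_left_mono finite_roots le_trans)
  finally show ?thesis
    using assms forestsD(6) by metis
qed

text \<open>The tree and its complement are both closed under \<open>B\<close>, which keeps the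
  grafts acyclic. The tree contains the single root \<open>s\<close> of \<open>B\<close> and no root
  of \<open>A\<close>, hence the shifts by one.\<close>

lemma swap:
  assumes "A \<in> forests i" "B \<in> forests (Suc j)" "s \<in> barren A B"
  shows "graft A (tree_of B s) B \<in> forests (Suc i)" "graft B (tree_of B s) A \<in> forests j"
    "sum v (graft A (tree_of B s) B) + sum v (graft B (tree_of B s) A) = sum v A + sum v B"
proof -
  let ?S = "tree_of B s"
  note A = forestsD[OF assms(1)] and B = forestsD[OF assms(2)] and s = barrenD[OF assms(3)]
  have RB: "roots U B \<inter> ?S = {s}" by (rule tree_of_inter_roots[OF assms(2) s(1)])
  have RA: "roots U A - ?S = roots U A" "roots U A \<inter> ?S = {}" using s(2) by auto
  have "roots U B - ?S = roots U B - {s}" using RB by auto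
  then have card: "card (roots U B - ?S) = j" using s(1) B(6) by simp
  have acyc: "acyclic (graft A ?S B)" "acyclic (graft B ?S A)"
    using acyclic_graft_closed[OF A(5) B(5) tree_of_closed[OF B(4) s(1)]]
      acyclic_graft_Compl_closed[OF B(5) A(5) tree_of_Compl_closed] .
  show "graft A ?S B \<in> forests (Suc i)"
    using graft_in_forests[OF assms(1,2) acyc(1)] by (simp add: RA RB A(6))
  show "graft B ?S A \<in> forests j"
    using graft_in_forests[OF assms(2,1) acyc(2)] by (simp add: RA card)
  show "sum v (graft A ?S B) + sum v (graft B ?S A) = sum v A + sum v B"
    by (rule sum_graft_swap[OF A(3) B(3)])
qed

text \<open>For neighbouring numbers of trees the exchange merely interchanges the numbers, so the
  total is still the sum of the two minima.\<close>

lemma swap_optimal: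
  assumes "A \<in> optimal i" "B \<in> optimal (Suc i)" "s \<in> barren A B"
  shows "graft A (tree_of B s) B \<in> optimal (Suc i)" "graft B (tree_of B s) A \<in> optimal i"
proof -
  note swap = swap[OF optimalD(1)[OF assms(1)] optimalD(1)[OF assms(2)] assms(3)]
  have "sum v (graft A (tree_of B s) B) + sum v (graft B (tree_of B s) A) \<le> sum v B + sum v A"
    using swap(3) by linarith
  from optimal_pair[OF assms(2,1) swap(1,2) this]
  show "graft A (tree_of B s) B \<in> optimal (Suc i)" "graft B (tree_of B s) A \<in> optimal i" by auto
qed

text \<open>The root \<open>s\<close> lies in exactly one of \<open>D\<close> and the rest of its
  tree, so the two partial grafts have \<open>i\<close> and \<open>Suc i\<close> trees in some
  order. Their total weight is that of \<open>G\<close> and the full graft, which are both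
  optimal.\<close>

lemma graft_part:
  assumes "G \<in> optimal (Suc i)" "A \<in> forests j" "s \<in> barren A G"
    and "graft G (tree_of G s) A \<in> optimal i"
    and "D \<subseteq> tree_of G s" "A `` D \<inter> (tree_of G s - D) = {}" "A `` (tree_of G s - D) \<inter> D = {}"
  shows "graft G D A \<in> optimal (if s \<in> D then i else Suc i)"
proof -
  let ?S = "tree_of G s"
  have G: "G \<in> forests (Suc i)" using optimalD(1)[OF assms(1)] .
  note A = forestsD[OF assms(2)] and G' = forestsD[OF G] and s = barrenD[OF assms(3)]
  have RG: "roots U G \<inter> ?S = {s}" by (rule tree_of_inter_roots[OF G s(1)])
  have graft_forests: "graft G D' A \<in> forests (if s \<in> D' then i else Suc i)"
    if "D' \<subseteq> ?S" "acyclic (graft G D' A)" for D'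
  proof -
    have "roots U A \<inter> D' = {}" using s(2) that by auto
    moreover have "roots U G - D' = (if s \<in> D' then roots U G - {s} else roots U G)"
      using RG that s(1) by auto
    ultimately show ?thesis
      using graft_in_forests[OF G assms(2) that(2)] G'(6) s(1) by (auto split: if_splits)
  qed
  have "acyclic (graft G D A)"
    using acyclic_graft_part[OF G'(5) A(5) tree_of_Compl_closed assms(5,6)] .
  moreover have "A `` (?S - D) \<inter> (?S - (?S - D)) = {}"
    using assms(7) by blast
  then have "acyclic (graft G (?S - D) A)"
    using acyclic_graft_part[OF G'(5) A(5) tree_of_Compl_closed Diff_subset] by blast
  ultimately have forests: "graft G D A \<in> forests (if s \<in> D then i else Suc i)"
    "graft G (?S - D) A \<in> forests (if s \<in> D then Suc i else i)"
    using graft_forests[of D] graft_forests[of "?S - D"] assms(5) by auto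
  have "sum v (graft G D A) + sum v (graft G (?S - D) A) = sum v G + sum v (graft G ?S A)"
    using sum_graft_split[OF G'(3) A(3) assms(5)] .
  then show ?thesis
    using forests optimal_pair[OF assms(4,1)] optimal_pair[OF assms(1,4)] by (auto split: if_splits)
qed

section \<open>The algebra generated by the trees of optimal forests\<close>

lemma algebra_tree_alg: "algebra U (tree_alg j)"
proof -
  have "algebra U (Pow U)" by (simp add: algebra_iff_Un)
  moreover have "\<forall>A \<in> optimal j. tree_of A ` roots U A \<subseteq> Pow U"
    using tree_of_subset_U optimalD(1) by blast
  ultimately have "tree_alg j \<subseteq> Pow U" by (auto simp: tree_alg_def)
  moreover have "{} \<in> tree_alg j" "\<And>a. a \<in> tree_alg j \<Longrightarrow> U - a \<in> tree_alg j"
    "\<And>a b. a \<in> tree_alg j \<Longrightarrow> b \<in> tree_alg j \<Longrightarrow> a \<union> b \<in> tree_alg j"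
    unfolding tree_alg_def algebra_iff_Un by blast+
  ultimately show ?thesis
    unfolding algebra_iff_Un by blast
qed

lemma tree_of_in_tree_alg: "A \<in> optimal j \<Longrightarrow> r \<in> roots U A \<Longrightarrow> tree_of A r \<in> tree_alg j"
  by (auto simp: tree_alg_def)

lemma tree_alg_subsetI:
  assumes "\<And>A r. A \<in> optimal i \<Longrightarrow> r \<in> roots U A \<Longrightarrow> tree_of A r \<in> tree_alg j"
  shows "tree_alg i \<subseteq> tree_alg j"
proof -
  have "tree_alg j \<in> {M. algebra U M \<and> (\<forall>A \<in> optimal i. tree_of A ` roots U A \<subseteq> M)}"
    using assms algebra_tree_alg[of j] by blast
  then show ?thesis unfolding tree_alg_def[of i] by (rule Inter_lower)
qed

lemma tree_alg_Int_Diff: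
  assumes "S \<in> tree_alg j" "T \<in> tree_alg j"
  shows "S \<inter> T \<in> tree_alg j" "S - T \<in> tree_alg j"
proof -
  interpret algebra U "tree_alg j" by (rule algebra_tree_alg)
  show "S \<inter> T \<in> tree_alg j" "S - T \<in> tree_alg j" using assms by auto
qed

text \<open>The trees of a forest partition \<open>U\<close>, so the union over \<open>R\<close> is
  the complement of the union of the remaining trees.\<close>

lemma Union_trees_in_tree_alg:
  assumes "A \<in> forests i" "R \<subseteq> roots U A" "\<And>r. r \<in> roots U A - R \<Longrightarrow> tree_of A r \<in> tree_alg j"
  shows "(\<Union>r \<in> R. tree_of A r) \<in> tree_alg j"
proof -
  interpret algebra U "tree_alg j" by (rule algebra_tree_alg)
  have "(\<Union>r \<in> R. tree_of A r) = U - (\<Union>r \<in> roots U A - R. tree_of A r)" (is "?L = U - ?R")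
  proof
    show "?L \<subseteq> U - ?R"
    proof
      fix x assume "x \<in> ?L"
      then obtain r where r: "r \<in> R" "x \<in> tree_of A r" by blast
      then have "x \<in> U" using assms(2) tree_of_subset_U[OF assms(1)] by blast
      moreover have "x \<notin> tree_of A s" if "s \<in> roots U A - R" for s
        using trees_disjoint[OF forestsD(4)[OF assms(1)], of r U s] r that assms(2) by blast
      ultimately show "x \<in> U - ?R" by blast
    qed
    show "U - ?R \<subseteq> ?L"
    proof
      fix x assume x: "x \<in> U - ?R"
      then obtain r where "r \<in> roots U A" "x \<in> tree_of A r"
        using ex_root[OF assms(1)] by blast
      with x show "x \<in> ?L" by blast
    qed
  qed
  moreover have "?R \<in> tree_alg j" using assms(3) by (intro finite_UN) auto
  ultimately show ?thesis by auto
qed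

text \<open>All trees of \<open>H\<close> but one reappear in an optimal forest with one tree more,
  obtained by grafting onto \<open>H\<close> a barren tree that lies inside the excepted one. The
  latter is then a complement.\<close>

lemma tree_alg_subset_Suc:
  assumes "forests (Suc k) \<noteq> {}"
  shows "tree_alg k \<subseteq> tree_alg (Suc k)"
proof (rule tree_alg_subsetI)
  fix H t assume H_Opt: "H \<in> optimal k" and t: "t \<in> roots U H"
  note H_For = optimalD(1)[OF H_Opt]
  note H = forestsD[OF H_For]
  obtain G where G_Opt: "G \<in> optimal (Suc k)" using optimal_nonempty[OF assms] by blast
  note G_For = optimalD(1)[OF G_Opt]
  note G = forestsD[OF G_For]
  have "barren H G \<noteq> {}" using card_barren[OF H_For G_For] by auto
  then obtain s where s: "s \<in> barren H G" by blast
  define S where "S = tree_of G s"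
  have sS: "s \<in> S" by (simp add: S_def)
  have "s \<in> U" using barrenD(1)[OF s] by (auto simp: roots_def)
  then obtain t\<^sub>0 where t0: "t\<^sub>0 \<in> roots U H" "s \<in> tree_of H t\<^sub>0"
    using ex_root[OF H_For] by blast
  define T where "T = tree_of H t\<^sub>0"
  have T_closed: "H `` T \<subseteq> T" "H `` (- T) \<subseteq> - T"
    using tree_of_closed[OF H(4) t0(1)] tree_of_Compl_closed[of H t\<^sub>0] by (simp_all add: T_def)
  \<comment> \<open>Shrinks the tree of \<open>s\<close> into \<open>T\<close>, so that the exchange with \<open>H\<close> cuts only the tree \<open>T\<close> of \<open>H\<close>.\<close>
  define G' where "G' = graft G (S - T) H"
  have "G' \<in> optimal (if s \<in> S - T then k else Suc k)"
    unfolding G'_def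
  proof (rule graft_part[OF G_Opt H_For s])
    show "graft G (tree_of G s) H \<in> optimal k" by (rule swap_optimal(2)[OF H_Opt G_Opt s])
    show "S - T \<subseteq> tree_of G s" by (auto simp: S_def)
    show "H `` (S - T) \<inter> (tree_of G s - (S - T)) = {}"
      using T_closed by (auto simp: S_def)
    show "H `` (tree_of G s - (S - T)) \<inter> (S - T) = {}"
      using T_closed by (auto simp: S_def)
  qed
  \<comment> \<open>As \<open>s\<close> lies in \<open>T\<close>, the graft on \<open>S - T\<close>
    keeps the root \<open>s\<close> and with it the number of trees.\<close>
  then have G'_Opt: "G' \<in> optimal (Suc k)" using t0(2) by (simp add: T_def)
  define S' where "S' = tree_of G' s"
  have S_Compl_closed: "G `` (- S) \<subseteq> - S"
    using tree_of_Compl_closed by (simp add: S_def)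
  \<comment> \<open>Arcs of \<open>G\<close> do not enter \<open>S\<close> from outside, and
    vertices of \<open>S - T\<close> now follow \<open>H\<close>, which does not enter
    \<open>T\<close> from outside.\<close>
  have S'_subset: "S' \<subseteq> S \<inter> T"
    unfolding S'_def
  proof (rule tree_of_subset)
    show "s \<in> S \<inter> T" using sS t0(2) by (simp add: T_def)
    fix x y assume "(x, y) \<in> G'" "y \<in> S \<inter> T"
    then show "x \<in> S \<inter> T"
      using S_Compl_closed T_closed by (auto simp: G'_def in_graft_iff split: if_splits)
  qed
  have s': "s \<in> roots U G'"
    using barrenD(1)[OF s] t0(2) by (auto simp: G'_def roots_graft T_def)
  have S_barren: "S \<inter> roots U H = {}" using barrenD(2)[OF s] by (simp add: S_def)
  then have s'_barren: "s \<in> barren H G'"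
    using s' S'_subset by (auto simp: barren_def S'_def)
  define K where "K = graft H S' G'"
  have K_Opt: "K \<in> optimal (Suc k)"
    using swap_optimal(1)[OF H_Opt G'_Opt s'_barren] by (simp add: K_def S'_def)
  have S'_closed: "G' `` S' \<subseteq> S'"
    using tree_of_closed[OF forestsD(4)[OF optimalD(1)[OF G'_Opt]] s'] by (simp add: S'_def)
  have other: "tree_of H r \<in> tree_alg (Suc k)" if r: "r \<in> roots U H - {t\<^sub>0}" for r
  proof -
    have disj: "tree_of H r \<inter> S' = {}"
      using trees_disjoint[OF H(4), of r U t\<^sub>0] r t0(1) S'_subset by (auto simp: T_def)
    \<comment> \<open>\<open>K\<close> differs from \<open>H\<close> only in arcs that start in
      \<open>S'\<close>, and in \<open>K\<close> these stay in \<open>S'\<close>, off the tree of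
      \<open>r\<close>.\<close>
    have "tree_of K r = tree_of H r"
    proof (rule tree_of_eqI[OF H(4)])
      show "r \<in> roots U H" using r by blast
      show "(x, y) \<in> K" if "x \<in> tree_of H r" "(x, y) \<in> H" for x y
        using that disj by (auto simp: K_def in_graft_iff)
      show "K `` (- tree_of H r) \<subseteq> - tree_of H r"
        using S'_closed disj tree_of_Compl_closed[of H r]
        by (fastforce simp: K_def in_graft_iff split: if_splits)
    qed
    moreover have "r \<in> roots U K"
      using r S_barren S'_subset by (auto simp: K_def roots_graft)
    ultimately show ?thesis using tree_of_in_tree_alg[OF K_Opt] by metis
  qed
  show "tree_of H t \<in> tree_alg (Suc k)"
  proof (cases "t = t\<^sub>0")
    case True
    then show ?thesis using Union_trees_in_tree_alg[OF H_For, of "{t\<^sub>0}"] t0(1) other by simp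
  qed (use t other in blast)
qed

end

section \<open>Equality of the algebras\<close>

text \<open>The \<open>k\<close> of this locale is \<open>k - 1\<close> in the theorem.\<close>

locale affine_min_weights = weighted_arcs +
  fixes k :: nat
  assumes nonempty: "forests k \<noteq> {}" "forests (Suc k) \<noteq> {}" "forests (Suc (Suc k)) \<noteq> {}"
    and affine: "\<And>F H G. F \<in> optimal k \<Longrightarrow> H \<in> optimal (Suc k) \<Longrightarrow> G \<in> optimal (Suc (Suc k)) \<Longrightarrow>
      sum v F + sum v G = 2 * sum v H"
begin

text \<open>The exchange yields two forests with \<open>Suc k\<close> trees whose total is, by
  \<open>affine\<close>, twice the minimum for that number. This is where the hypothesis on the
  weights enters.\<close>

lemma swap_optimal_middle:
  assumes "F \<in> optimal k" "G \<in> optimal (Suc (Suc k))" "s \<in> barren F G"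
  shows "graft F (tree_of G s) G \<in> optimal (Suc k)" "graft G (tree_of G s) F \<in> optimal (Suc k)"
proof -
  obtain H where H: "H \<in> optimal (Suc k)" using optimal_nonempty nonempty(2) by blast
  note swap = swap[OF optimalD(1)[OF assms(1)] optimalD(1)[OF assms(2)] assms(3)]
  have "sum v (graft F (tree_of G s) G) + sum v (graft G (tree_of G s) F) \<le> sum v H + sum v H"
    using swap(3) affine[OF assms(1) H assms(2)] by linarith
  from optimal_pair[OF H H swap(1,2) this]
  show "graft F (tree_of G s) G \<in> optimal (Suc k)" "graft G (tree_of G s) F \<in> optimal (Suc k)" by auto
qed

text \<open>\<open>G\<close> has \<open>k + 2\<close> trees and \<open>F\<close> only
  \<open>k\<close> roots.\<close>

lemma two_barren_roots:
  assumes "F \<in> optimal k" "G \<in> optimal (Suc (Suc k))"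
  obtains s t where "s \<in> barren F G" "t \<in> barren F G" "s \<noteq> t"
proof -
  have "Suc (Suc 0) \<le> card (barren F G)"
    using card_barren[OF optimalD(1)[OF assms(1)] optimalD(1)[OF assms(2)]] by simp
  then show ?thesis using that
    by (auto simp: card_le_Suc_iff)
qed

text \<open>Exchanging one of the two trees only lets the third one grow into it, so the two enlarged trees
  intersect in the third tree.\<close>

lemma third_tree_in_tree_alg:
  assumes F: "F \<in> optimal k" and G: "G \<in> optimal (Suc (Suc k))"
    and s: "s \<in> barren F G" "t \<in> barren F G" "s \<noteq> t"
    and r: "r \<in> roots U G" "r \<noteq> s" "r \<noteq> t"
  shows "tree_of G r \<in> tree_alg (Suc k)"
proof -
  note G' = forestsD[OF optimalD(1)[OF G]]
  have enlarged: "tree_of (graft G (tree_of G q) F) r \<in> tree_alg (Suc k)"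
    "tree_of G r \<subseteq> tree_of (graft G (tree_of G q) F) r"
    "tree_of (graft G (tree_of G q) F) r \<subseteq> tree_of G r \<union> tree_of G q"
    if q: "q \<in> barren F G" "r \<noteq> q" for q
  proof -
    let ?H = "graft G (tree_of G q) F"
    have disj: "tree_of G r \<inter> tree_of G q = {}"
      using trees_disjoint[OF G'(4) r(1) barrenD(1)[OF q(1)] q(2)] .
    then have "r \<notin> tree_of G q" using root_mem_tree_of[of r G] by blast
    with r(1) have "r \<in> roots U ?H" by (simp add: roots_graft)
    then show "tree_of ?H r \<in> tree_alg (Suc k)"
      by (rule tree_of_in_tree_alg[OF swap_optimal_middle(2)[OF F G q(1)]])
    show "tree_of G r \<subseteq> tree_of ?H r"
    proof
      fix x assume x: "x \<in> tree_of G r"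
      then have "(x, r) \<in> G\<^sup>*" by (simp add: tree_of_def)
      then have "(x, r) \<in> ?H\<^sup>* \<and> r \<in> tree_of G r"
        by (rule rtrancl_agree_on_closed[OF _ x tree_of_closed[OF G'(4) r(1)]])
          (use disj in \<open>auto simp: in_graft_iff\<close>)
      then show "x \<in> tree_of ?H r" by (simp add: tree_of_def)
    qed
    show "tree_of ?H r \<subseteq> tree_of G r \<union> tree_of G q"
    proof (rule tree_of_subset)
      fix x y assume "(x, y) \<in> ?H" "y \<in> tree_of G r \<union> tree_of G q"
      then show "x \<in> tree_of G r \<union> tree_of G q"
        using tree_of_Compl_closed[of G r] tree_of_Compl_closed[of G q]
        by (auto simp: in_graft_iff split: if_splits)
    qed simp
  qed
  have "tree_of G s \<inter> tree_of G t = {}"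
    using trees_disjoint[OF G'(4) barrenD(1)[OF s(1)] barrenD(1)[OF s(2)] s(3)] .
  then have "tree_of G r =
      tree_of (graft G (tree_of G s) F) r \<inter> tree_of (graft G (tree_of G t) F) r"
    using enlarged(2,3)[OF s(1) r(2)] enlarged(2,3)[OF s(2) r(3)] by blast
  then show ?thesis
    using tree_alg_Int_Diff(1)[OF enlarged(1)[OF s(1) r(2)] enlarged(1)[OF s(2) r(3)]] by simp
qed

text \<open>The union of the two trees is in the algebra, so one of them suffices.  Some arc \<open>(x, y)\<close> of \<open>F\<close>
  leaves the union; exchanging the part of the tree of \<open>x\<close> that \<open>F\<close> carries to \<open>x\<close> keeps the other
  tree intact.  The result either has one tree less, which is the middle number, or the same number of trees
  with the tree of \<open>x\<close> made smaller.\<close>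

lemma barren_pair_in_tree_alg:
  assumes F: "F \<in> optimal k"
  shows "G \<in> optimal (Suc (Suc k)) \<Longrightarrow> s \<in> barren F G \<Longrightarrow> t \<in> barren F G \<Longrightarrow> s \<noteq> t \<Longrightarrow>
    tree_of G s \<in> tree_alg (Suc k) \<and> tree_of G t \<in> tree_alg (Suc k)"
proof (induction "card (tree_of G s) + card (tree_of G t)" arbitrary: G s t rule: less_induct)
  case less
  note F_For = optimalD(1)[OF F] and G_For = optimalD(1)[OF less.prems(1)]
  note F' = forestsD[OF F_For] and G' = forestsD[OF G_For]
  have union: "tree_of G p \<union> tree_of G q \<in> tree_alg (Suc k)"
    if "p \<in> barren F G" "q \<in> barren F G" "p \<noteq> q" for p q
    using Union_trees_in_tree_alg[OF G_For, of "{p, q}"] barrenD(1)[OF that(1)] barrenD(1)[OF that(2)]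
      third_tree_in_tree_alg[OF F less.prems(1) that] by auto
  \<comment> \<open>Stated for \<open>p\<close> and \<open>q\<close> because \<open>x\<close> may
    lie in either of the two trees. Only the tree of \<open>q\<close> shrinks, and the induction
    hypothesis is passed in that form.\<close>
  have key: "tree_of G p \<in> tree_alg (Suc k)"
    if p: "p \<in> barren F G" and q: "q \<in> barren F G" and pq: "p \<noteq> q"
      and x: "x \<in> tree_of G q" "(x, y) \<in> F" "y \<notin> tree_of G p \<union> tree_of G q"
      and IH: "\<And>G'. G' \<in> optimal (Suc (Suc k)) \<Longrightarrow> tree_of G' p = tree_of G p \<Longrightarrow>
        tree_of G' q \<subset> tree_of G q \<Longrightarrow> p \<in> barren F G' \<Longrightarrow> q \<in> barren F G' \<Longrightarrow>
        tree_of G' p \<in> tree_alg (Suc k)" for p q x y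
  proof -
    define P where "P = tree_of G p"
    define Q where "Q = tree_of G q"
    have disj: "P \<inter> Q = {}"
      using trees_disjoint[OF G'(4) barrenD(1)[OF p] barrenD(1)[OF q] pq]
      by (simp add: P_def Q_def)
    \<comment> \<open>The vertices that \<open>F\<close> carries to \<open>x\<close> without leaving
      \<open>Q\<close>. The only arc of \<open>F\<close> that leaves \<open>D\<close> is
      \<open>(x, y)\<close>, and no arc of \<open>F\<close> leads from \<open>Q - D\<close> into
      \<open>D\<close>.\<close>
    define D where "D = {z \<in> Q. (z, x) \<in> (F \<inter> Q \<times> Q)\<^sup>*}"
    have D_sub: "D \<subseteq> Q" and xD: "x \<in> D" using x(1) by (auto simp: D_def Q_def)
    have into_D: "z \<in> D" if "(z, z') \<in> F" "z \<in> Q" "z' \<in> D" for z z'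
      using that by (auto simp: D_def intro: converse_rtrancl_into_rtrancl)
    have from_D: "z' \<in> D \<or> z' \<notin> P \<union> Q" if "(z, z') \<in> F" "z \<in> D" for z z'
    proof -
      have "(z, x) \<in> (F \<inter> Q \<times> Q)\<^sup>*" using that(2) by (simp add: D_def)
      then show ?thesis
      proof (cases rule: converse_rtranclE)
        case base
        then have "z' = y" using that(1) x(2) F'(4) by (auto dest: single_valuedD)
        then show ?thesis using x(3) by (simp add: P_def Q_def)
      next
        case (step w)
        then have "z' = w" using that(1) F'(4) by (auto dest: single_valuedD)
        then show ?thesis using step by (simp add: D_def)
      qed
    qed
    define K where "K = graft G D F"
    \<comment> \<open>If \<open>q\<close> lies in \<open>D\<close>, this root is lost and
      \<open>K\<close> has the middle number of trees; otherwise the number stays and the induction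
      applies to \<open>K\<close>.\<close>
    have K: "K \<in> optimal (if q \<in> D then Suc k else Suc (Suc k))"
      unfolding K_def
    proof (rule graft_part[OF less.prems(1) F_For q])
      show "graft G (tree_of G q) F \<in> optimal (Suc k)"
        by (rule swap_optimal_middle(2)[OF F less.prems(1) q])
      show "D \<subseteq> tree_of G q" using D_sub by (simp add: Q_def)
      show "F `` D \<inter> (tree_of G q - D) = {}" using from_D by (auto simp: Q_def)
      show "F `` (tree_of G q - D) \<inter> D = {}" using into_D by (auto simp: Q_def)
    qed
    have K_P: "tree_of K p = tree_of G p"
    proof (rule tree_of_eqI[OF G'(4) barrenD(1)[OF p]])
      show "(a, b) \<in> K" if "a \<in> tree_of G p" "(a, b) \<in> G" for a b
        using that D_sub disj by (auto simp: K_def in_graft_iff P_def)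
      show "K `` (- tree_of G p) \<subseteq> - tree_of G p"
      proof
        fix b assume "b \<in> K `` (- tree_of G p)"
        then obtain a where "(a, b) \<in> K" "a \<notin> P" by (auto simp: P_def)
        then show "b \<in> - tree_of G p"
          using tree_of_Compl_closed[of G p] from_D[of a b] D_sub disj
          by (auto simp: K_def in_graft_iff P_def split: if_splits)
      qed
    qed
    have pP: "p \<in> P" "q \<in> Q" by (simp_all add: P_def Q_def)
    have pK: "p \<in> roots U K"
      using barrenD(1)[OF p] pP D_sub disj by (auto simp: K_def roots_graft)
    show ?thesis
    proof (cases "q \<in> D")
      case True
      then show ?thesis using tree_of_in_tree_alg[OF _ pK] K K_P by fastforce
    next
      case False
      then have K_Opt: "K \<in> optimal (Suc (Suc k))" using K by simp
      have qK: "q \<in> roots U K" using barrenD(1)[OF q] False by (simp add: K_def roots_graft)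
      \<comment> \<open>The tree of \<open>q\<close> loses at least \<open>x\<close>, so the
        induction measure decreases.\<close>
      have "tree_of K q \<subseteq> Q - D"
      proof (rule tree_of_subset)
        show "q \<in> Q - D" using pP False by simp
        show "a \<in> Q - D" if "(a, b) \<in> K" "b \<in> Q - D" for a b
          using that tree_of_Compl_closed[of G q] from_D[of a b]
          by (auto simp: K_def in_graft_iff Q_def split: if_splits)
      qed
      then have "tree_of K q \<subset> tree_of G q"
        using xD D_sub by (auto simp: Q_def)
      moreover from this have "p \<in> barren F K" "q \<in> barren F K"
        using pK qK barrenD(2)[OF p] barrenD(2)[OF q] K_P by (auto simp: barren_def)
      ultimately show ?thesis using IH[OF K_Opt K_P] K_P by simp
    qed
  qed
  have fin: "finite (tree_of G r)" if "r \<in> barren F G" for r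
    using tree_of_subset_U[OF G_For barrenD(1)[OF that]] finite_U by (rule finite_subset)
  have disj: "tree_of G s \<inter> tree_of G t = {}"
    using trees_disjoint[OF G'(4) barrenD(1)[OF less.prems(2)] barrenD(1)[OF less.prems(3)]
      less.prems(4)] .
  note union_Diff = tree_alg_Int_Diff(2)[OF union[OF less.prems(2-4)]]
  \<comment> \<open>The root to which \<open>F\<close> leads \<open>s\<close> lies outside both
    barren trees, so the path has to leave their union.\<close>
  have "s \<in> U" using barrenD(1)[OF less.prems(2)] by (simp add: roots_def)
  then obtain r where r: "r \<in> roots U F" "(s, r) \<in> F\<^sup>*"
    using ex_root[OF F_For] by (auto simp: tree_of_def)
  have "s \<in> tree_of G s \<union> tree_of G t" by simp
  moreover have "r \<notin> tree_of G s \<union> tree_of G t"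
    using r(1) barrenD(2)[OF less.prems(2)] barrenD(2)[OF less.prems(3)] by blast
  ultimately obtain x y where xy: "(x, y) \<in> F" "x \<in> tree_of G s \<union> tree_of G t"
      "y \<notin> tree_of G s \<union> tree_of G t"
    by (rule rtrancl_exit[OF r(2)])
  show ?case
  proof (cases "x \<in> tree_of G t")
    case True
    have s_in: "tree_of G s \<in> tree_alg (Suc k)"
    proof (rule key[OF less.prems(2,3,4) True xy(1,3)])
      fix G' assume G': "G' \<in> optimal (Suc (Suc k))" "tree_of G' s = tree_of G s"
        "tree_of G' t \<subset> tree_of G t" "s \<in> barren F G'" "t \<in> barren F G'"
      have "card (tree_of G' s) + card (tree_of G' t) < card (tree_of G s) + card (tree_of G t)"
        using psubset_card_mono[OF fin[OF less.prems(3)] G'(3)] G'(2) by simp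
      from less.hyps[OF this G'(1,4,5) less.prems(4)]
      show "tree_of G' s \<in> tree_alg (Suc k)" by (rule conjunct1)
    qed
    have "tree_of G s \<union> tree_of G t - tree_of G s = tree_of G t" using disj by blast
    then show ?thesis using s_in union_Diff[OF s_in] by simp
  next
    case False
    then have x: "x \<in> tree_of G s" using xy(2) by blast
    have t_in: "tree_of G t \<in> tree_alg (Suc k)"
    proof (rule key[OF less.prems(3,2) less.prems(4)[symmetric] x xy(1)])
      show "y \<notin> tree_of G t \<union> tree_of G s" using xy(3) by blast
      fix G' assume G': "G' \<in> optimal (Suc (Suc k))" "tree_of G' t = tree_of G t"
        "tree_of G' s \<subset> tree_of G s" "t \<in> barren F G'" "s \<in> barren F G'"
      have "card (tree_of G' s) + card (tree_of G' t) < card (tree_of G s) + card (tree_of G t)"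
        using psubset_card_mono[OF fin[OF less.prems(2)] G'(3)] G'(2) by simp
      from less.hyps[OF this G'(1,5,4) less.prems(4)]
      show "tree_of G' t \<in> tree_alg (Suc k)" by (rule conjunct2)
    qed
    have "tree_of G s \<union> tree_of G t - tree_of G t = tree_of G s" using disj by blast
    then show ?thesis using t_in union_Diff[OF t_in] by simp
  qed
qed

text \<open>One inclusion is the comparison of neighbouring numbers. For the other, each tree of
  \<open>G\<close> is either one of two barren trees or a third tree.\<close>

lemma tree_alg_eq: "tree_alg (Suc k) = tree_alg (Suc (Suc k))"
proof
  show "tree_alg (Suc k) \<subseteq> tree_alg (Suc (Suc k))"
    by (rule tree_alg_subset_Suc) (rule nonempty)
  obtain F where F: "F \<in> optimal k" using optimal_nonempty nonempty(1) by blast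
  show "tree_alg (Suc (Suc k)) \<subseteq> tree_alg (Suc k)"
  proof (rule tree_alg_subsetI)
    fix G r assume G: "G \<in> optimal (Suc (Suc k))" and r: "r \<in> roots U G"
    obtain s t where st: "s \<in> barren F G" "t \<in> barren F G" "s \<noteq> t"
      using two_barren_roots[OF F G] .
    show "tree_of G r \<in> tree_alg (Suc k)"
      using barren_pair_in_tree_alg[OF F G st] third_tree_in_tree_alg[OF F G st r] by blast
  qed
qed

text \<open>Barren trees of \<open>G\<close> belong to the algebra, so an atom lies inside or off
  each of them. Of two disjoint ones at least one misses \<open>X\<close> and serves as
  \<open>D\<close>.\<close>

lemma agree_on_elementary_set:
  assumes F: "F \<in> optimal k" and G: "G \<in> optimal (Suc (Suc k))"
    and X: "X \<in> elementary_sets (tree_alg (Suc k))"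
  obtains D where "D \<inter> X = {}" "graft F D G \<in> optimal (Suc k)" "graft G D F \<in> optimal (Suc k)"
proof -
  obtain s t where st: "s \<in> barren F G" "t \<in> barren F G" "s \<noteq> t"
    using two_barren_roots[OF F G] .
  have "tree_of G s \<inter> tree_of G t = {}"
    using trees_disjoint[OF forestsD(4)[OF optimalD(1)[OF G]] barrenD(1)[OF st(1)] barrenD(1)[OF st(2)]
      st(3)] .
  moreover have "X \<subseteq> tree_of G s \<or> tree_of G s \<inter> X = {}"
  proof -
    have "tree_of G s \<inter> X \<in> tree_alg (Suc k)"
      using tree_alg_Int_Diff(1) barren_pair_in_tree_alg[OF F G st] X by (simp add: elementary_sets_def)
    moreover have "S = X" if "S \<in> tree_alg (Suc k)" "S \<noteq> {}" "S \<subseteq> X" for S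
      using X that by (simp add: elementary_sets_def)
    ultimately show ?thesis by (metis Int_lower1 Int_lower2)
  qed
  ultimately have "tree_of G s \<inter> X = {} \<or> tree_of G t \<inter> X = {}" by blast
  then show ?thesis
  proof
    assume "tree_of G s \<inter> X = {}"
    from that[OF this swap_optimal_middle[OF F G st(1)]] show ?thesis .
  next
    assume "tree_of G t \<inter> X = {}"
    from that[OF this swap_optimal_middle[OF F G st(2)]] show ?thesis .
  qed
qed

end

section \<open>Digraphs given by their arc relation\<close>

text \<open>Both end maps are the projections, so equality of such digraphs is equality of vertex
  sets and arc relations.\<close>

definition arc_graph :: "'a set \<Rightarrow> 'a rel \<Rightarrow> ('a, 'a \<times> 'a) pre_digraph" where
  "arc_graph U A = with_proj \<lparr>pverts = U, parcs = A\<rparr>"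

lemma arc_graph_simps [simp]:
  "verts (arc_graph U A) = U" "arcs (arc_graph U A) = A" "arcs_ends (arc_graph U A) = A"
  "tail (arc_graph U A) = fst" "head (arc_graph U A) = snd"
  by (simp_all add: arc_graph_def)

lemma arc_graph_eqI:
  "verts F = U \<Longrightarrow> arcs F = A \<Longrightarrow> tail F = fst \<Longrightarrow> head F = snd \<Longrightarrow> F = arc_graph U A"
  by (rule pre_digraph.equality) simp_all

lemma arc_graph_eq_iff: "arc_graph U A = arc_graph W B \<longleftrightarrow> U = W \<and> A = B"
  by (metis arc_graph_simps(1,2))

lemma arc_graph_restrict: "arc_graph U A \<restriction> S = arc_graph S (A \<inter> S \<times> S)"
  by (rule arc_graph_eqI) auto

lemma wf_digraph_arc_graph: "wf_digraph (arc_graph U A) \<longleftrightarrow> A \<subseteq> U \<times> U"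
  by (auto simp: wf_digraph_def)

lemma subgraph_arc_graph_iff:
  "subgraph F (arc_graph U A) \<longleftrightarrow>
    A \<subseteq> U \<times> U \<and> (\<exists>W B. F = arc_graph W B \<and> W \<subseteq> U \<and> B \<subseteq> A \<and> B \<subseteq> W \<times> W)"
proof
  assume F: "subgraph F (arc_graph U A)"
  then have "F = arc_graph (verts F) (arcs F)"
    by (intro arc_graph_eqI) (auto simp: subgraph_def compatible_def)
  with F show "A \<subseteq> U \<times> U \<and> (\<exists>W B. F = arc_graph W B \<and> W \<subseteq> U \<and> B \<subseteq> A \<and> B \<subseteq> W \<times> W)"
    unfolding subgraph_def by (metis arc_graph_simps(1,2) wf_digraph_arc_graph)
qed (auto simp: subgraph_def wf_digraph_arc_graph compatible_def)

text \<open>A nonempty closed walk contains a cycle, and a cycle is itself such a walk.\<close>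

lemma forest_arc_graph:
  assumes "A \<subseteq> U \<times> U"
  shows "forest (arc_graph U A) \<longleftrightarrow> acyclic A"
proof -
  interpret wf_digraph "arc_graph U A" using assms by (simp add: wf_digraph_arc_graph)
  have "(\<exists>x. (x, x) \<in> A\<^sup>+) \<longleftrightarrow> (\<exists>u p. awalk u p u \<and> p \<noteq> [])"
    using reachable1_awalk by simp
  also have "\<dots> \<longleftrightarrow> (\<exists>p. cycle p)"
    using closed_w_imp_cycle by (auto simp: closed_w_def cycle_def)
  finally show ?thesis unfolding forest_def acyclic_def by blast
qed

lemma directed_forest_arc_graph:
  assumes "finite U" "A \<subseteq> U \<times> U"
  shows "directed_forest (arc_graph U A) \<longleftrightarrow> single_valued A \<and> acyclic A"
proof -
  have "finite A" using finite_subset[OF assms(2)] assms(1) by blast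
  then have fin: "fin_digraph (arc_graph U A)"
    using assms by (simp add: fin_digraph_def fin_digraph_axioms_def wf_digraph_arc_graph)
  have "out_degree (arc_graph U A) u \<le> 1 \<longleftrightarrow> (\<forall>x y. (u, x) \<in> A \<longrightarrow> (u, y) \<in> A \<longrightarrow> x = y)" for u
  proof -
    \<comment> \<open>Finiteness matters: \<open>card\<close> of an infinite set is
      \<open>0\<close>, so the degree bound alone would not give uniqueness.\<close>
    have "finite (out_arcs (arc_graph U A) u)"
      using \<open>finite A\<close> by (simp add: out_arcs_def)
    then have "out_degree (arc_graph U A) u \<le> 1 \<longleftrightarrow>
        (\<forall>e \<in> out_arcs (arc_graph U A) u. \<forall>e' \<in> out_arcs (arc_graph U A) u. e = e')"
      by (simp add: out_degree_def card_le_Suc0_iff_eq)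
    then show ?thesis by fastforce
  qed
  then have "(\<forall>u \<in> U. out_degree (arc_graph U A) u \<le> 1) \<longleftrightarrow> single_valued A"
    using assms(2) by (auto simp: single_valued_def)
  then show ?thesis
    using fin forest_arc_graph[OF assms(2)] by (auto simp: directed_forest_def)
qed

text \<open>If arcs of \<open>A\<close> leave neither \<open>S\<close> nor its complement,
  undirected walks cannot leave \<open>S\<close> either.\<close>

lemma symcl_arcs_closed:
  assumes "(x, y) \<in> rtrancl_on W (B\<^sup>s)" "x \<in> S" "B \<subseteq> A" "A `` S \<subseteq> S" "A `` (- S) \<subseteq> - S"
  shows "y \<in> S"
  using assms(1,2)
proof (induction rule: rtrancl_on_induct)
  case (step y z)
  then show ?case using assms(3-5) by (fastforce simp: symcl_def)
qed

text \<open>Every vertex is joined to \<open>r\<close> within the tree; reversing one such walk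
  connects any two vertices through \<open>r\<close>.\<close>

lemma connected_tree_of:
  assumes "single_valued A" "r \<in> roots U A" "A \<subseteq> U \<times> U"
  shows "Digraph_Component.connected (arc_graph (tree_of A r) (A \<inter> tree_of A r \<times> tree_of A r))"
proof -
  let ?S = "tree_of A r" and ?B = "A \<inter> tree_of A r \<times> tree_of A r"
  have to_root: "(x, r) \<in> rtrancl_on ?S (?B\<^sup>s)" if "x \<in> ?S" for x
  proof -
    have "(x, r) \<in> A\<^sup>*" using that by (simp add: tree_of_def)
    then show ?thesis
    proof (induction rule: converse_rtrancl_induct)
      case base
      then show ?case by (simp add: rtrancl_on_refl)
    next
      case (step x y)
      then have "x \<in> ?S" "y \<in> ?S"
        by (auto simp: tree_of_def intro: converse_rtrancl_into_rtrancl)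
      with step show ?case
        by (intro converse_rtrancl_on_into_rtrancl_on[of x y]) (auto simp: symcl_def)
    qed
  qed
  have "sym (?B\<^sup>s)" by (auto simp: symcl_def sym_def)
  then have "sym (rtrancl_on ?S (?B\<^sup>s))" by (rule rtrancl_on_sym)
  then have "(x, y) \<in> rtrancl_on ?S (?B\<^sup>s)" if "x \<in> ?S" "y \<in> ?S" for x y
    using to_root[OF that(1)] to_root[OF that(2)] by (meson rtrancl_on_trans symD)
  moreover have "?S \<noteq> {}" using root_mem_tree_of by fast
  ultimately show ?thesis by (simp add: connected_conv)
qed

lemma trees_arc_graph:
  assumes "finite U" "A \<subseteq> U \<times> U" "single_valued A" "acyclic A"
  shows "trees (arc_graph U A) = (\<lambda>r. arc_graph U A \<restriction> tree_of A r) ` roots U A"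
proof -
  let ?T = "\<lambda>r. arc_graph (tree_of A r) (A \<inter> tree_of A r \<times> tree_of A r)"
  have "finite A" using finite_subset[OF assms(2)] assms(1) by blast
  have sub_U: "tree_of A r \<subseteq> U" if "r \<in> roots U A" for r
    using that assms(2) by (intro tree_of_subset) (auto simp: roots_def)
  have T: "subgraph (?T r) (arc_graph U A)" "Digraph_Component.connected (?T r)"
    if "r \<in> roots U A" for r
    using sub_U[OF that] connected_tree_of[OF assms(3) that assms(2)] assms(2)
    by (auto simp: subgraph_arc_graph_iff)
  \<comment> \<open>A connected subgraph that meets a tree lies in it. This shows both that
    components are trees and that trees are maximal.\<close>
  have contained: "subgraph H (?T r)"
    if sub: "subgraph H (arc_graph U A)" and conn: "Digraph_Component.connected H"
      and x: "x \<in> verts H" "x \<in> tree_of A r" and r: "r \<in> roots U A" for H x r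
  proof -
    obtain W B where H: "H = arc_graph W B" "B \<subseteq> A" "B \<subseteq> W \<times> W"
      using sub by (auto simp: subgraph_arc_graph_iff)
    have "y \<in> tree_of A r" if y: "y \<in> W" for y
    proof (rule symcl_arcs_closed)
      show "(x, y) \<in> rtrancl_on W (B\<^sup>s)"
        using conn x(1) y by (simp add: H(1) connected_conv)
    qed (use H(2) x(2) tree_of_closed[OF assms(3) r] tree_of_Compl_closed[of A r] in auto)
    then show ?thesis using H unfolding subgraph_arc_graph_iff by blast
  qed
  have "pre_digraph.max_subgraph (arc_graph U A) Digraph_Component.connected H \<longleftrightarrow>
      (\<exists>r \<in> roots U A. H = ?T r)" for H
  proof
    assume max: "pre_digraph.max_subgraph (arc_graph U A) Digraph_Component.connected H"
    then have H: "subgraph H (arc_graph U A)" "Digraph_Component.connected H"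
      by (auto simp: pre_digraph.max_subgraph_def)
    then obtain x where x: "x \<in> verts H" by (auto simp: connected_conv)
    then have "x \<in> U" using H(1) by (auto simp: subgraph_arc_graph_iff)
    then obtain r where r: "r \<in> roots U A" "(x, r) \<in> A\<^sup>*"
      using reaches_root[OF \<open>finite A\<close> assms(4,2)] by blast
    then have "subgraph H (?T r)" using contained[OF H x _ r(1)] r(2) by (simp add: tree_of_def)
    then show "\<exists>r \<in> roots U A. H = ?T r"
      using max T[OF r(1)] r(1) unfolding pre_digraph.max_subgraph_def by metis
  next
    assume "\<exists>r \<in> roots U A. H = ?T r"
    then obtain r where r: "r \<in> roots U A" "H = ?T r" by blast
    show "pre_digraph.max_subgraph (arc_graph U A) Digraph_Component.connected H"
    proof (rule pre_digraph.max_subgraphI)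
      show "Digraph_Component.connected H" "subgraph H (arc_graph U A)" using T r by auto
      fix H' assume H': "H \<noteq> H'" "subgraph H H'" "subgraph H' (arc_graph U A)"
      show "\<not> Digraph_Component.connected H'"
      proof
        assume conn: "Digraph_Component.connected H'"
        have "r \<in> verts H'" using H'(2) r(2) by (auto simp: subgraph_def)
        then have "subgraph H' H" using contained[OF H'(3) conn _ _ r(1)] r(2) by simp
        then obtain W B where WB: "H' = arc_graph W B" "W \<subseteq> tree_of A r"
            "B \<subseteq> A \<inter> tree_of A r \<times> tree_of A r"
          unfolding r(2) subgraph_arc_graph_iff by blast
        moreover have "tree_of A r \<subseteq> W" "A \<inter> tree_of A r \<times> tree_of A r \<subseteq> B"
          using H'(2) unfolding r(2) WB(1) subgraph_def by simp_all
        ultimately have "H' = ?T r" by (simp add: arc_graph_eq_iff subset_antisym)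
        with H'(1) r(2) show False by simp
      qed
    qed
  qed
  then show ?thesis by (auto simp: trees_def arc_graph_restrict)
qed

lemma verts_trees_arc_graph:
  assumes "finite U" "A \<subseteq> U \<times> U" "single_valued A" "acyclic A"
  shows "verts ` trees (arc_graph U A) = tree_of A ` roots U A"
  by (simp add: trees_arc_graph[OF assms] image_image)

lemma card_trees_arc_graph:
  assumes "finite U" "A \<subseteq> U \<times> U" "single_valued A" "acyclic A"
  shows "card (trees (arc_graph U A)) = card (roots U A)"
proof -
  have "inj_on (\<lambda>r. arc_graph U A \<restriction> tree_of A r) (roots U A)"
  proof (rule inj_onI)
    fix r s assume "r \<in> roots U A" "s \<in> roots U A"
      "arc_graph U A \<restriction> tree_of A r = arc_graph U A \<restriction> tree_of A s"
    then show "r = s"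
      using trees_disjoint[OF assms(3), of r U s] root_mem_tree_of[of r A]
      by (auto simp: arc_graph_restrict arc_graph_eq_iff)
  qed
  then show ?thesis by (simp add: trees_arc_graph[OF assms] card_image)
qed

section \<open>Transfer of forests, minima and algebras to digraphs\<close>

locale weighted_pair_digraph = pair_fin_digraph +
  fixes v :: "'a \<times> 'a \<Rightarrow> real"

sublocale weighted_pair_digraph \<subseteq> weighted_arcs "pverts G" "parcs G" v
  using pair_finite_verts by unfold_locales (auto dest: in_arcsD1 in_arcsD2)

context weighted_pair_digraph
begin

lemma spanning_forests_eq: "spanning_forests (with_proj G) j = arc_graph (pverts G) ` forests j"
proof -
  have G: "with_proj G = arc_graph (pverts G) (parcs G)" by (rule arc_graph_eqI) simp_all
  have span: "spanning F (with_proj G) \<longleftrightarrow> (\<exists>A \<subseteq> parcs G. F = arc_graph (pverts G) A)" for F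
    unfolding spanning_def G subgraph_arc_graph_iff using E_subset
    by (auto simp: arc_graph_eq_iff)
  have forests: "arc_graph (pverts G) A \<in> spanning_forests (with_proj G) j \<longleftrightarrow> A \<in> forests j"
    if "A \<subseteq> parcs G" for A
  proof -
    have "A \<subseteq> pverts G \<times> pverts G" using that E_subset by blast
    then show ?thesis
      using that span[of "arc_graph (pverts G) A"] directed_forest_arc_graph[OF finite_U, of A]
        card_trees_arc_graph[OF finite_U, of A]
      by (auto simp: spanning_forests_def forests_def)
  qed
  have ex: "\<exists>A \<subseteq> parcs G. F = arc_graph (pverts G) A"
    if "F \<in> spanning_forests (with_proj G) j" for F
    using that by (simp add: spanning_forests_def span)
  show ?thesis
  proof (intro equalityI subsetI)
    fix F assume F: "F \<in> spanning_forests (with_proj G) j"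
    then obtain A where "A \<subseteq> parcs G" "F = arc_graph (pverts G) A" using ex by blast
    then show "F \<in> arc_graph (pverts G) ` forests j" using F forests by auto
  next
    fix F assume "F \<in> arc_graph (pverts G) ` forests j"
    then obtain A where "A \<in> forests j" "F = arc_graph (pverts G) A" by blast
    then show "F \<in> spanning_forests (with_proj G) j" using forests[OF forestsD(1)] by auto
  qed
qed

lemma weight_arc_graph: "weight v (arc_graph U A) = sum v A"
  by (simp add: weight_def)

lemma min_weight_eq:
  assumes "A \<in> optimal j"
  shows "min_weight (with_proj G) v j = ereal (sum v A)"
  unfolding min_weight_def spanning_forests_eq image_image weight_arc_graph
proof (rule antisym)
  show "(INF B \<in> forests j. ereal (sum v B)) \<le> ereal (sum v A)"
    by (rule INF_lower[OF optimalD(1)[OF assms]])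
  show "ereal (sum v A) \<le> (INF B \<in> forests j. ereal (sum v B))"
    by (rule INF_greatest) (simp add: optimalD(2)[OF assms])
qed

lemma min_forests_eq: "min_forests (with_proj G) v j = arc_graph (pverts G) ` optimal j"
proof (cases "forests j = {}")
  case True
  then show ?thesis by (auto simp: min_forests_def spanning_forests_eq optimal_def)
next
  case False
  then obtain A where A: "A \<in> optimal j" using optimal_nonempty by blast
  then have "B \<in> optimal j \<longleftrightarrow> B \<in> forests j \<and> sum v B = sum v A" for B
    by (auto simp: optimal_def intro: antisym)
  then show ?thesis
    by (auto simp: min_forests_def spanning_forests_eq min_weight_eq[OF A] weight_arc_graph)
qed

lemma tree_algebra_eq: "tree_algebra (with_proj G) v j = tree_alg j"
proof -
  have "verts ` trees (arc_graph (pverts G) A) = tree_of A ` roots (pverts G) A"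
    if "A \<in> optimal j" for A
    using verts_trees_arc_graph[OF finite_U] forestsD[OF optimalD(1)[OF that]] by blast
  then show ?thesis by (simp add: tree_algebra_def tree_alg_def min_forests_eq)
qed

end

text \<open>Grafting changes only arcs that start in \<open>D\<close>, and the induced subgraph on
  \<open>S\<close> has none of these.\<close>

lemma restrict_arc_graph_graft:
  assumes "D \<inter> S = {}"
  shows "arc_graph U (graft A D B) \<restriction> S = arc_graph U A \<restriction> S"
proof -
  have "graft A D B \<inter> S \<times> S = A \<inter> S \<times> S" using assms by (auto simp: graft_def)
  then show ?thesis by (simp add: arc_graph_restrict)
qed

theorem theorem3:
  fixes V :: "nat pair_pre_digraph"
    and v :: "nat \<times> nat \<Rightarrow> real"
    and N k :: nat
  assumes "pair_wf_digraph V"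
    and "pverts V = {1..N}"
    and "2 \<le> k" and "k \<le> N - 1"
    and "spanning_forests (with_proj V) (k - 1) \<noteq> {}"
    and "min_weight (with_proj V) v (k - 1) - min_weight (with_proj V) v k =
         min_weight (with_proj V) v k - min_weight (with_proj V) v (k + 1)"
  shows "tree_algebra (with_proj V) v k = tree_algebra (with_proj V) v (k + 1) \<and>
    (\<forall>E \<in> elementary_sets (tree_algebra (with_proj V) v k).
      restrict_graphs (min_forests (with_proj V) v (k - 1)) E
        \<subseteq> restrict_graphs (min_forests (with_proj V) v k) E \<and>
      restrict_graphs (min_forests (with_proj V) v (k + 1)) E
        \<subseteq> restrict_graphs (min_forests (with_proj V) v k) E)"
proof -
  interpret pair_wf_digraph V by fact
  have "finite (parcs V)"
    by (rule finite_subset[of _ "{1..N} \<times> {1..N}"])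
      (auto simp flip: assms(2) dest: in_arcsD1 in_arcsD2 simp: assms(2))
  then interpret W: weighted_pair_digraph V v
    by unfold_locales (simp_all add: assms(2))
  obtain m where k: "k = Suc m" using assms(3) by (cases k) auto
  have "card (pverts V) = N" by (simp add: assms(2))
  \<comment> \<open>Both \<open>k - 1\<close> and \<open>k\<close> are below the number of vertices,
    so deleting arcs gives forests with \<open>k\<close> and \<open>k + 1\<close> trees.\<close>
  then have lt: "m < card (pverts V)" "Suc m < card (pverts V)"
    using assms(3,4) k by linarith+
  have ne0: "W.forests m \<noteq> {}" using assms(5) by (auto simp: W.spanning_forests_eq k)
  have ne1: "W.forests (Suc m) \<noteq> {}" by (rule W.forests_Suc_nonempty[OF ne0 lt(1)])
  have ne2: "W.forests (Suc (Suc m)) \<noteq> {}" by (rule W.forests_Suc_nonempty[OF ne1 lt(2)])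
  interpret A: affine_min_weights "pverts V" "parcs V" v m
  proof (unfold_locales)
    fix F H G
    assume "F \<in> W.optimal m" "H \<in> W.optimal (Suc m)" "G \<in> W.optimal (Suc (Suc m))"
    \<comment> \<open>All three minima are attained, so the equation in extended reals is one
      between real numbers.\<close>
    then show "sum v F + sum v G = 2 * sum v H"
      using assms(6) by (simp add: k W.min_weight_eq)
  qed (fact ne0 ne1 ne2)+
  \<comment> \<open>A fixed minimal forest at each end serves as partner in the exchange with an
    arbitrary one at the other end.\<close>
  obtain F\<^sub>0 where F0: "F\<^sub>0 \<in> W.optimal m" using W.optimal_nonempty[OF ne0] by blast
  obtain G\<^sub>0 where G0: "G\<^sub>0 \<in> W.optimal (Suc (Suc m))" using W.optimal_nonempty[OF ne2] by blast
  let ?res = "\<lambda>j. restrict_graphs (min_forests (with_proj V) v j)"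
  have "?res (k - 1) E \<subseteq> ?res k E \<and> ?res (k + 1) E \<subseteq> ?res k E"
    if E: "E \<in> elementary_sets (W.tree_alg (Suc m))" for E
  proof (intro conjI subsetI)
    fix X assume "X \<in> ?res (k - 1) E"
    then obtain F where F: "F \<in> W.optimal m" "X = arc_graph (pverts V) F \<restriction> E"
      by (auto simp: restrict_graphs_def W.min_forests_eq k)
    obtain D where D: "D \<inter> E = {}" "graft F D G\<^sub>0 \<in> W.optimal (Suc m)"
      using A.agree_on_elementary_set[OF F(1) G0 E] .
    show "X \<in> ?res k E"
      unfolding restrict_graphs_def W.min_forests_eq image_image F(2) k
      using D(2) by (rule rev_image_eqI) (simp add: restrict_arc_graph_graft[OF D(1)])
  next
    fix X assume "X \<in> ?res (k + 1) E"
    then obtain G where G: "G \<in> W.optimal (Suc (Suc m))" "X = arc_graph (pverts V) G \<restriction> E"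
      by (auto simp: restrict_graphs_def W.min_forests_eq k)
    obtain D where D: "D \<inter> E = {}" "graft G D F\<^sub>0 \<in> W.optimal (Suc m)"
      using A.agree_on_elementary_set[OF F0 G(1) E] .
    show "X \<in> ?res k E"
      unfolding restrict_graphs_def W.min_forests_eq image_image G(2) k
      using D(2) by (rule rev_image_eqI) (simp add: restrict_arc_graph_graft[OF D(1)])
  qed
  then show ?thesis
    using A.tree_alg_eq by (simp add: W.tree_algebra_eq k)
qed

end
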